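(* Let $\mathbb{F}_q$ be a finite field of characteristic $p\ge 3$, and let $I_{\mathrm{D}}(q)$ be the number of $\mathbb{F}_q$-isomorphism classes of elliptic curves in the family $\mathbf{E}_{\mathrm{D},u}: Y^2=X^3+uX^2+16uX$, $u\in\mathbb{F}_q\setminus\{0,64\}$. Then $$ I_{\mathrm{D}}(q)=\begin{cases} (11q+1)/12-N/8 & \text{if } q\equiv 1\pmod{12},\\ (11q-7)/12-N/8 & \text{if } q\equiv 5\pmod{12},\\ (11q-5)/12-N/8 & \text{if } q\equiv 7\pmod{12},\\ (11q-13)/12-N/8 & \text{if } q\equiv 11\pmod{12},\\ (19q-27)/24 & \text{if } q=3^{2k},\\ (19q-33)/24 & \text{if } q=3^{2k+1}, \end{cases}$$ where $N$ is the number of $\mathbb{F}_q$-rational points on the elliptic curve $L: Y^2=X(X+1)(X+3/4)$.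
   Context: The condition $u\ne 0,64$ ensures that $\mathbf{E}_{\mathrm{D},u}$ is nonsingular, hence an elliptic curve (with the point at infinity as base point). Two elliptic curves given by Weierstrass equations over $\mathbb{F}_q$ are $\mathbb{F}_q$-isomorphic if there is a change of variables between them of the form $(x,y)\mapsto(\alpha^2x+r,\alpha^3y+\alpha^2sx+t)$ with $\alpha,r,s,t\in\mathbb{F}_q$, $\alpha\neq 0$. Thus $I_{\mathrm{D}}(q)$ is the number of classes into which the curves $\mathbf{E}_{\mathrm{D},u}$, $u\in\mathbb{F}_q\setminus\{0,64\}$, are partitioned by $\mathbb{F}_q$-isomorphism. $N=\#L(\mathbb{F}_q)$ is the number of points of the elliptic curve $L$, including the point at infinity (it is used only when $p\geq 5$). In the last two cases $k$ denotes a nonnegative integer (positive in the case $q=3^{2k}$). *)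

theory Defs
  imports Complex_Main "HOL-Library.Cardinality" "HOL-Computational_Algebra.Polynomial"
begin

datatype 'a weierstrass =
  Weierstrass (coeff_a1: 'a) (coeff_a2: 'a) (coeff_a3: 'a) (coeff_a4: 'a) (coeff_a6: 'a)

text \<open>
  The defining expression
  \<open>Y\<^sup>2 + a\<^sub>1 X Y + a\<^sub>3 Y - (X\<^sup>3 + a\<^sub>2 X\<^sup>2 + a\<^sub>4 X + a\<^sub>6)\<close>, evaluated at elements \<open>x\<close>, \<open>y\<close> of a
  ring into which the coefficients are mapped by \<open>\<phi>\<close>. Two instances are used: \<open>\<phi> = id\<close> for
  points over the base field, and the embedding of the base field into the bivariate
  polynomials, so that equations are compared as formal polynomials and not merely as
  functions on a finite field.
\<close>

definition weierstrass_expr :: "('a \<Rightarrow> 'b) \<Rightarrow> 'a weierstrass \<Rightarrow> 'b \<Rightarrow> 'b \<Rightarrow> 'b::comm_ring_1" where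
  "weierstrass_expr \<phi> E x y =
     y ^ 2 + \<phi> (coeff_a1 E) * x * y + \<phi> (coeff_a3 E) * y
     - (x ^ 3 + \<phi> (coeff_a2 E) * x ^ 2 + \<phi> (coeff_a4 E) * x + \<phi> (coeff_a6 E))"

text \<open>Bivariate polynomials are polynomials in \<open>Y\<close> over polynomials in \<open>X\<close>.\<close>

definition bconst :: "'a::comm_ring_1 \<Rightarrow> 'a poly poly" where
  "bconst c = [:[:c:]:]"

definition bvar_X :: "'a::comm_ring_1 poly poly" where
  "bvar_X = [:[:0, 1:]:]"

definition bvar_Y :: "'a::comm_ring_1 poly poly" where
  "bvar_Y = [:0, 1:]"

text \<open>
  \<open>(x, y) \<mapsto> (\<alpha>\<^sup>2 x + r, \<alpha>\<^sup>3 y + \<alpha>\<^sup>2 s x + t)\<close> carries \<open>E'\<close> to \<open>E\<close>: substituting it into the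
  equation of \<open>E\<close> gives the equation of \<open>E'\<close> up to a unit factor, which must be \<open>\<alpha>\<^sup>6\<close> because
  both equations are monic in \<open>Y\<close>.
\<close>

definition weierstrass_iso :: "'a::field weierstrass \<Rightarrow> 'a weierstrass \<Rightarrow> bool" where
  "weierstrass_iso E E' \<longleftrightarrow>
     (\<exists>\<alpha> r s t. \<alpha> \<noteq> 0 \<and>
        weierstrass_expr bconst E
          (bconst (\<alpha> ^ 2) * bvar_X + bconst r)
          (bconst (\<alpha> ^ 3) * bvar_Y + bconst (\<alpha> ^ 2 * s) * bvar_X + bconst t)
        = bconst (\<alpha> ^ 6) * weierstrass_expr bconst E' bvar_X bvar_Y)"

text \<open>\<open>None\<close> is the point at infinity.\<close>

definition rational_points :: "'a::field weierstrass \<Rightarrow> ('a \<times> 'a) option set" where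
  "rational_points E = insert None (Some ` {(x, y). weierstrass_expr id E x y = 0})"

definition E_D :: "'a::field \<Rightarrow> 'a weierstrass" where
  "E_D u = Weierstrass 0 u 0 (16 * u) 0"

definition family_D :: "'a::field weierstrass set" where
  "family_D = E_D ` {u. u \<noteq> 0 \<and> u \<noteq> 64}"

definition iso_classes_D :: "'a::field weierstrass set set" where
  "iso_classes_D = family_D // {(E, E'). E \<in> family_D \<and> E' \<in> family_D \<and> weierstrass_iso E E'}"

definition I_D :: "'a::{field, finite} itself \<Rightarrow> nat" where
  "I_D _ = card (iso_classes_D :: 'a weierstrass set set)"

text \<open>\<open>X (X + 1) (X + 3/4) = X\<^sup>3 + (1 + 3/4) X\<^sup>2 + (3/4) X\<close>\<close>

definition curve_L :: "'a::field weierstrass" where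
  "curve_L = Weierstrass 0 (1 + 3/4) 0 (3/4) 0"

lemma weierstrass_expr_E_D:
  "weierstrass_expr id (E_D u) x y = 0 \<longleftrightarrow> y ^ 2 = x ^ 3 + u * x ^ 2 + 16 * u * x"
  by (simp add: weierstrass_expr_def E_D_def)

lemma weierstrass_expr_curve_L:
  "weierstrass_expr id curve_L x y = 0 \<longleftrightarrow> y ^ 2 = x * (x + 1) * (x + 3/4)"
proof -
  have "weierstrass_expr id curve_L x y = y ^ 2 - x * (x + 1) * (x + c)" if "c = 3/4" for c
    unfolding weierstrass_expr_def curve_L_def that [symmetric]
    by (simp add: algebra_simps power2_eq_square power3_eq_cube)
  from this [OF refl] show ?thesis by simp
qed

lemma weierstrass_iso_iff:
  "weierstrass_iso (Weierstrass a1 a2 a3 a4 a6) (Weierstrass b1 b2 b3 b4 b6) \<longleftrightarrow>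
     (\<exists>\<alpha> r s t. \<alpha> \<noteq> 0 \<and>
        \<alpha> * b1 = a1 + 2 * s \<and>
        \<alpha> ^ 2 * b2 = a2 - s * a1 + 3 * r - s ^ 2 \<and>
        \<alpha> ^ 3 * b3 = a3 + r * a1 + 2 * t \<and>
        \<alpha> ^ 4 * b4 = a4 - s * a3 + 2 * r * a2 - (t + r * s) * a1 + 3 * r ^ 2 - 2 * s * t \<and>
        \<alpha> ^ 6 * b6 = a6 + r * a4 + r ^ 2 * a2 + r ^ 3 - t * a3 - t ^ 2 - r * t * a1)"
proof -
  have "weierstrass_expr bconst (Weierstrass a1 a2 a3 a4 a6)
          (bconst (\<alpha> ^ 2) * bvar_X + bconst r)
          (bconst (\<alpha> ^ 3) * bvar_Y + bconst (\<alpha> ^ 2 * s) * bvar_X + bconst t)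
        = bconst (\<alpha> ^ 6) * weierstrass_expr bconst (Weierstrass b1 b2 b3 b4 b6) bvar_X bvar_Y \<longleftrightarrow>
        \<alpha> * b1 = a1 + 2 * s \<and>
        \<alpha> ^ 2 * b2 = a2 - s * a1 + 3 * r - s ^ 2 \<and>
        \<alpha> ^ 3 * b3 = a3 + r * a1 + 2 * t \<and>
        \<alpha> ^ 4 * b4 = a4 - s * a3 + 2 * r * a2 - (t + r * s) * a1 + 3 * r ^ 2 - 2 * s * t \<and>
        \<alpha> ^ 6 * b6 = a6 + r * a4 + r ^ 2 * a2 + r ^ 3 - t * a3 - t ^ 2 - r * t * a1"
    (is "?L = ?R \<longleftrightarrow> ?C") if "\<alpha> \<noteq> 0" for \<alpha> r s t
  proof -
    let ?d0 = "t^2 + a3*t + a1*r*t - r^3 - a2*r^2 - a4*r - a6"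
    let ?d1 = "\<alpha>^2 * (2*s*t + a1*t + a1*r*s + a3*s - 3*r^2 - 2*a2*r - a4)"
    let ?d2 = "\<alpha>^4 * (s^2 + a1*s - 3*r - a2)"
    let ?e0 = "\<alpha>^3 * (2*t + a1*r + a3)"
    let ?e1 = "\<alpha>^5 * (2*s + a1)"
    have L: "?L = [:[:?d0, ?d1, ?d2, -(\<alpha>^6):], [:?e0, ?e1:], [:\<alpha>^6:]:]"
      by (simp add: weierstrass_expr_def bconst_def bvar_X_def bvar_Y_def
          power2_eq_square power3_eq_cube algebra_simps eval_nat_numeral)
    have R: "?R = [:[:-(\<alpha>^6*b6), -(\<alpha>^6*b4), -(\<alpha>^6*b2), -(\<alpha>^6):], [:\<alpha>^6*b3, \<alpha>^6*b1:], [:\<alpha>^6:]:]"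
      by (simp add: weierstrass_expr_def bconst_def bvar_X_def bvar_Y_def
          power2_eq_square power3_eq_cube algebra_simps eval_nat_numeral)
    have "?L = ?R \<longleftrightarrow>
        ?e1 = \<alpha>^5 * (\<alpha>*b1) \<and> ?d2 = \<alpha>^4 * (-(\<alpha>^2*b2)) \<and> ?e0 = \<alpha>^3 * (\<alpha>^3*b3) \<and>
        ?d1 = \<alpha>^2 * (-(\<alpha>^4*b4)) \<and> ?d0 = -(\<alpha>^6*b6)"
      unfolding L R by (auto simp: power_add [symmetric] mult.assoc [symmetric] eval_nat_numeral)
    also have "\<dots> \<longleftrightarrow> ?C"
    proof -
      have eq_iff: "p = q \<longleftrightarrow> m = n" if "p - q = m - n \<or> p - q = n - m" for p q m n :: 'a
        using that by (metis right_minus_eq)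
      show ?thesis
        using that unfolding mult_cancel_left
        by (intro conj_cong; simp) (rule eq_iff; simp add: algebra_simps)+
    qed
    finally show ?thesis .
  qed
  then show ?thesis unfolding weierstrass_iso_def by blast
qed

lemma weierstrass_iso_refl: "weierstrass_iso E E"
proof (cases E)
  case (Weierstrass a1 a2 a3 a4 a6)
  then show ?thesis
    by (simp only: weierstrass_iso_iff)
       (rule exI [of _ 1], rule exI [of _ 0], rule exI [of _ 0], rule exI [of _ 0], simp)
qed

lemma weierstrass_iso_trans:
  assumes "weierstrass_iso E F" "weierstrass_iso F G"
  shows "weierstrass_iso E G"
proof -
  obtain a1 a2 a3 a4 a6 where E: "E = Weierstrass a1 a2 a3 a4 a6" by (cases E)
  obtain b1 b2 b3 b4 b6 where F: "F = Weierstrass b1 b2 b3 b4 b6" by (cases F)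
  obtain c1 c2 c3 c4 c6 where G: "G = Weierstrass c1 c2 c3 c4 c6" by (cases G)
  obtain \<alpha> r s t where 1: "\<alpha> \<noteq> 0"
      "\<alpha> * b1 = a1 + 2 * s"
      "\<alpha> ^ 2 * b2 = a2 - s * a1 + 3 * r - s ^ 2"
      "\<alpha> ^ 3 * b3 = a3 + r * a1 + 2 * t"
      "\<alpha> ^ 4 * b4 = a4 - s * a3 + 2 * r * a2 - (t + r * s) * a1 + 3 * r ^ 2 - 2 * s * t"
      "\<alpha> ^ 6 * b6 = a6 + r * a4 + r ^ 2 * a2 + r ^ 3 - t * a3 - t ^ 2 - r * t * a1"
    using assms(1) unfolding E F weierstrass_iso_iff by blast
  obtain \<beta> r' s' t' where 2: "\<beta> \<noteq> 0"
      "\<beta> * c1 = b1 + 2 * s'"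
      "\<beta> ^ 2 * c2 = b2 - s' * b1 + 3 * r' - s' ^ 2"
      "\<beta> ^ 3 * c3 = b3 + r' * b1 + 2 * t'"
      "\<beta> ^ 4 * c4 = b4 - s' * b3 + 2 * r' * b2 - (t' + r' * s') * b1 + 3 * r' ^ 2 - 2 * s' * t'"
      "\<beta> ^ 6 * c6 = b6 + r' * b4 + r' ^ 2 * b2 + r' ^ 3 - t' * b3 - t' ^ 2 - r' * t' * b1"
    using assms(2) unfolding F G weierstrass_iso_iff by blast
  show ?thesis
    unfolding E G weierstrass_iso_iff
    apply (rule exI [of _ "\<alpha> * \<beta>"], rule exI [of _ "\<alpha>^2 * r' + r"],
           rule exI [of _ "\<alpha> * s' + s"], rule exI [of _ "\<alpha>^3 * t' + \<alpha>^2 * s * r' + t"])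
    apply (intro conjI)
    subgoal using 1(1) 2(1) by simp
    subgoal using 1(2-) 2(2-) by algebra
    subgoal using 1(2-) 2(2-) by algebra
    subgoal using 1(2-) 2(2-) by algebra
    subgoal using 1(2-) 2(2-) by algebra
    subgoal using 1(2-) 2(2-) by algebra
    done
qed

lemma weierstrass_iso_sym:
  assumes "weierstrass_iso E F"
  shows "weierstrass_iso F E"
proof -
  obtain a1 a2 a3 a4 a6 where E: "E = Weierstrass a1 a2 a3 a4 a6" by (cases E)
  obtain b1 b2 b3 b4 b6 where F: "F = Weierstrass b1 b2 b3 b4 b6" by (cases F)
  obtain \<alpha> r s t where 1: "\<alpha> \<noteq> 0"
      "\<alpha> * b1 = a1 + 2 * s"
      "\<alpha> ^ 2 * b2 = a2 - s * a1 + 3 * r - s ^ 2"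
      "\<alpha> ^ 3 * b3 = a3 + r * a1 + 2 * t"
      "\<alpha> ^ 4 * b4 = a4 - s * a3 + 2 * r * a2 - (t + r * s) * a1 + 3 * r ^ 2 - 2 * s * t"
      "\<alpha> ^ 6 * b6 = a6 + r * a4 + r ^ 2 * a2 + r ^ 3 - t * a3 - t ^ 2 - r * t * a1"
    using assms unfolding E F weierstrass_iso_iff by blast
  define i where "i = inverse \<alpha>"
  have i: "i \<noteq> 0" using 1(1) by (simp add: i_def)
  have solve: "b = i ^ n * c" if "\<alpha> ^ n * b = c" for n b c
    using that 1(1) by (auto simp: i_def field_simps)
  have b: "b1 = i ^ 1 * (a1 + 2 * s)"
      "b2 = i ^ 2 * (a2 - s * a1 + 3 * r - s ^ 2)"
      "b3 = i ^ 3 * (a3 + r * a1 + 2 * t)"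
      "b4 = i ^ 4 * (a4 - s * a3 + 2 * r * a2 - (t + r * s) * a1 + 3 * r ^ 2 - 2 * s * t)"
      "b6 = i ^ 6 * (a6 + r * a4 + r ^ 2 * a2 + r ^ 3 - t * a3 - t ^ 2 - r * t * a1)"
    using 1(2-) by (intro solve; simp)+
  show ?thesis
    unfolding E F weierstrass_iso_iff b
    apply (rule exI [of _ i], rule exI [of _ "- (i^2 * r)"],
           rule exI [of _ "- (i * s)"], rule exI [of _ "i^3 * (s * r - t)"])
    apply (intro conjI)
    subgoal by (rule i)
    subgoal by algebra
    subgoal by algebra
    subgoal by algebra
    subgoal by algebra
    subgoal by algebra
    done
qed

lemma equiv_family_D:
  "equiv family_D {(E, E'). E \<in> family_D \<and> E' \<in> family_D \<and> weierstrass_iso E E'}"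
  by (rule equivI)
     (auto simp: refl_on_def sym_def trans_def
           intro: weierstrass_iso_refl weierstrass_iso_sym weierstrass_iso_trans)

end

theory Submission
  imports Defs
begin

text \<open>
  A curve \<open>E_D u\<close> is isomorphic to at most two further members of the family, one for each
  2-torsion point other than the origin. Parametrising such points by \<open>z\<close>, the isomorphism exists
  over the base field iff \<open>z (z + 1) (z - 3)\<close> is a nonzero square, a condition which becomes the
  equation of \<open>L\<close> under \<open>z = 4 X + 3\<close>. A class of size \<open>1 + g\<close> with \<open>g \<le> 2\<close> has weight
  \<open>1 / (1 + g) = 1 - g / 2 + g (g - 1) / 6\<close>, so the number of classes follows from the number of
  parameters \<open>z\<close> and the number of those whose conjugate parameter is also admissible. The second
  condition turns out to be that \<open>cubic (- z)\<close> is a square, and the character sum of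
  \<open>cubic z * cubic (- z)\<close> is again that of the cubic, up to elementary terms. The quadratic
  characters of \<open>-1\<close> and \<open>-3\<close> produce the dependence on \<open>q\<close> modulo 12.
\<close>

section \<open>Equivalence classes counted by inverse class size\<close>

lemma card_quotient_eq_sum_inverse:
  assumes "finite A" "equiv A r"
  shows "real (card (A // r)) = (\<Sum>a\<in>A. 1 / real (card (r `` {a})))"
proof -
  have fin: "finite (A // r)" "\<forall>C\<in>A // r. finite C"
    using finite_quotient[OF assms(1) equiv_type[OF assms(2)]]
      finite_equiv_class[OF assms(1) equiv_type[OF assms(2)]] by blast+
  \<comment> \<open>All members of a class \<open>C\<close> carry the same weight
    \<open>1 / card C\<close>, so together they contribute 1.\<close>
  have class_sum: "(\<Sum>a\<in>C. 1 / real (card (r `` {a}))) = 1" if "C \<in> A // r" for C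
  proof -
    have "r `` {a} = C" if "a \<in> C" for a
      using that \<open>C \<in> A // r\<close> assms(2) by (metis Image_singleton_iff equiv_class_eq quotientE)
    moreover have "card C \<noteq> 0"
      using that fin in_quotient_imp_non_empty[OF assms(2)] by auto
    ultimately show ?thesis by simp
  qed
  have "(\<Sum>a\<in>A. 1 / real (card (r `` {a}))) = (\<Sum>a\<in>\<Union>(A // r). 1 / real (card (r `` {a})))"
    using Union_quotient[OF assms(2)] by simp
  also have "\<dots> = (\<Sum>C\<in>A // r. \<Sum>a\<in>C. 1 / real (card (r `` {a})))"
    using fin quotient_disj[OF assms(2)] by (subst sum.Union_disjoint) auto
  finally show ?thesis using class_sum by simp
qed

section \<open>Elementary facts on finite fields\<close>

lemma card_ge_2: "CARD('a::{zero_neq_one, finite}) \<ge> 2"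
  using card_mono[of UNIV "{0, 1 :: 'a}"] by simp

text \<open>Translation by 1 permutes the field, so adding 1 to every element leaves the total
  unchanged. This later ties the characteristic to \<open>q\<close>.\<close>

lemma of_nat_card_eq_0: "of_nat (CARD('a::{ring_1, finite})) = (0::'a)"
proof -
  have "bij_betw (\<lambda>x::'a. x + 1) UNIV UNIV"
    by (rule bij_betw_byWitness[of _ "\<lambda>x. x - 1"]) auto
  hence "(\<Sum>x\<in>(UNIV::'a set). x + 1) = \<Sum>UNIV"
    by (rule sum.reindex_bij_betw)
  thus ?thesis by (simp add: sum.distrib)
qed

text \<open>Multiplication by \<open>x\<close> permutes the nonzero elements, and their product is a
  nonzero factor that cancels.\<close>

lemma finite_field_power_card_minus_1:
  fixes x :: "'a::{field, finite}"
  assumes "x \<noteq> 0"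
  shows "x ^ (CARD('a) - 1) = 1"
proof -
  let ?U = "UNIV - {0 :: 'a}"
  have "bij_betw ((*) x) ?U ?U"
    by (rule bij_betw_byWitness[of _ "\<lambda>y. y / x"]) (use assms in auto)
  hence "(\<Prod>y\<in>?U. x * y) = \<Prod>?U"
    by (rule prod.reindex_bij_betw)
  moreover have "\<Prod>?U \<noteq> 0" by simp
  ultimately show ?thesis
    by (simp add: prod.distrib card_Diff_singleton)
qed

text \<open>\<open>X^n - 1\<close> has at most \<open>n\<close> roots. This replaces a generator of
  the multiplicative group when the characters of \<open>-1\<close> and \<open>-3\<close> are
  computed.\<close>

lemma exists_power_neq_1:
  assumes "0 < n" "n < CARD('a) - 1"
  obtains x :: "'a::{field, finite}" where "x \<noteq> 0" "x ^ n \<noteq> 1"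
proof (rule ccontr)
  assume *: "\<not> thesis"
  let ?p = "monom 1 n - 1 :: 'a poly"
  have deg: "degree ?p = n" using assms(1)
    using degree_add_eq_left[of "-1" "monom 1 n :: 'a poly"] by (simp add: degree_monom_eq)
  hence "?p \<noteq> 0" using assms(1) by auto
  have "UNIV - {0} \<subseteq> {x. poly ?p x = 0}"
    using * that by (auto simp: poly_monom)
  hence "CARD('a) - 1 \<le> card {x. poly ?p x = 0}"
    using card_mono[of "{x. poly ?p x = 0}" "UNIV - {0}"] by (simp add: card_Diff_singleton)
  also have "\<dots> \<le> n"
    using card_poly_roots_bound[OF \<open>?p \<noteq> 0\<close>] deg by simp
  finally show False using assms(2) by simp
qed

section \<open>The quadratic character and its values at -1 and -3\<close>

definition quad_char :: "'a::field \<Rightarrow> real" where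
  "quad_char x = (if x = 0 then 0 else if \<exists>y. x = y\<^sup>2 then 1 else -1)"

lemma quad_char_0 [simp]: "quad_char 0 = 0"
  by (simp add: quad_char_def)

lemma quad_char_eq_0_iff [simp]: "quad_char x = 0 \<longleftrightarrow> x = 0"
  by (simp add: quad_char_def)

lemma quad_char_eq_1_iff: "quad_char x = 1 \<longleftrightarrow> x \<noteq> 0 \<and> (\<exists>y. x = y\<^sup>2)"
  by (simp add: quad_char_def)

lemma quad_char_square: "y \<noteq> 0 \<Longrightarrow> quad_char (y\<^sup>2) = 1"
  by (auto simp: quad_char_def)

lemma quad_char_1 [simp]: "quad_char 1 = 1"
  using quad_char_square[of 1] by simp

lemma quad_char_cases: "x \<noteq> 0 \<Longrightarrow> quad_char x = 1 \<or> quad_char x = -1"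
  by (simp add: quad_char_def)

lemma card_square_roots:
  assumes "(2::'a::{field, finite}) \<noteq> 0"
  shows "real (card {y::'a. y\<^sup>2 = a}) = 1 + quad_char a"
proof (cases "\<exists>b. a = b\<^sup>2")
  case True
  then obtain b where b: "a = b\<^sup>2" by blast
  have "{y. y\<^sup>2 = a} = {b, -b}" by (auto simp: b power2_eq_iff)
  moreover have "b = -b \<longleftrightarrow> b = 0"
  proof
    assume "b = -b"
    hence "2 * b = 0" by (metis add.right_inverse mult_2)
    thus "b = 0" using assms by simp
  qed simp
  ultimately show ?thesis using b by (cases "b = 0") (auto simp: quad_char_square)
next
  case False
  moreover from this have "a \<noteq> 0" by (metis zero_power2)
  moreover have "{y. y\<^sup>2 = a} = {}" using False by auto
  ultimately show ?thesis by (simp add: quad_char_def)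
qed

text \<open>Counting the field by the fibres of squaring gives \<open>q\<close> as the sum of all
  \<open>1 + quad_char a\<close>.\<close>

lemma sum_quad_char:
  assumes "(2::'a::{field, finite}) \<noteq> 0"
  shows "(\<Sum>a\<in>(UNIV::'a set). quad_char a) = 0"
proof -
  have "(\<Sum>a\<in>(UNIV::'a set). card {y::'a. y\<^sup>2 = a}) = card (UNIV :: 'a set)"
    using sum.group[of "UNIV::'a set" UNIV "\<lambda>y. y\<^sup>2" "\<lambda>_. 1::nat"] by simp
  hence "(\<Sum>a\<in>(UNIV::'a set). real (card {y::'a. y\<^sup>2 = a})) = real (CARD('a))"
    by (metis of_nat_sum)
  thus ?thesis by (simp add: card_square_roots[OF assms] sum.distrib)
qed

lemma quad_char_mult_square:
  assumes "c \<noteq> 0"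
  shows "quad_char (x * c\<^sup>2) = quad_char x"
proof -
  have "(\<exists>y. x * c\<^sup>2 = y\<^sup>2) \<longleftrightarrow> (\<exists>y. x = y\<^sup>2)"
  proof
    assume "\<exists>y. x * c\<^sup>2 = y\<^sup>2"
    then obtain y where "x * c\<^sup>2 = y\<^sup>2" by blast
    hence "x = (y / c)\<^sup>2" using assms by (simp add: field_simps)
    thus "\<exists>y. x = y\<^sup>2" by blast
  next
    assume "\<exists>y. x = y\<^sup>2"
    thus "\<exists>y. x * c\<^sup>2 = y\<^sup>2" by (metis power_mult_distrib)
  qed
  thus ?thesis using assms by (simp add: quad_char_def)
qed

text \<open>The case of a nonsquare \<open>x\<close> is the substantial one. The terms
  \<open>quad_char z + quad_char (x * z)\<close> sum to 0 and none is positive: for a nonzero square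
  \<open>z\<close> the second summand is -1, for a nonsquare the first is. Hence every term
  vanishes.\<close>

lemma quad_char_mult:
  fixes x y :: "'a::{field, finite}"
  assumes two: "(2::'a) \<noteq> 0"
  shows "quad_char (x * y) = quad_char x * quad_char y"
proof (cases "x = 0")
  case False
  consider "quad_char x = 1" | "quad_char x = -1" using False quad_char_cases by blast
  thus ?thesis
  proof cases
    case 1
    then obtain c where "x = c\<^sup>2" using quad_char_eq_1_iff by blast
    thus ?thesis using False 1 quad_char_mult_square[of c y] by (simp add: mult.commute)
  next
    case 2
    have "bij_betw ((*) x) UNIV UNIV"
      by (rule bij_betw_byWitness[of _ "\<lambda>y. y / x"]) (use False in auto)
    hence "(\<Sum>z\<in>UNIV. quad_char (x * z)) = 0"
      using sum.reindex_bij_betw sum_quad_char[OF two] by metis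
    hence "(\<Sum>z\<in>UNIV. quad_char z + quad_char (x * z)) = 0"
      by (simp add: sum.distrib sum_quad_char[OF two])
    moreover have "0 \<le> - (quad_char z + quad_char (x * z))" for z
    proof (cases "quad_char z = 1")
      case True
      then obtain c where "z = c\<^sup>2" "z \<noteq> 0" using quad_char_eq_1_iff by blast
      thus ?thesis using 2 True quad_char_mult_square[of c x] by simp
    next
      case False
      thus ?thesis by (cases "z = 0") (auto simp: quad_char_def split: if_splits)
    qed
    ultimately have "quad_char z + quad_char (x * z) = 0" for z
      using sum_nonneg_0[of "UNIV :: 'a set" "\<lambda>z. - (quad_char z + quad_char (x * z))" z]
      by (simp add: sum_negf del: minus_add_distrib)
    hence "quad_char y + quad_char (x * y) = 0" .
    thus ?thesis using 2 by simp
  qed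
qed simp

lemma odd_card_if_two_neq_0:
  assumes two: "(2::'a::{field, finite}) \<noteq> 0"
  shows "odd (CARD('a))"
proof
  assume "even (CARD('a))"
  hence "odd (CARD('a) - 1)"
    by (simp add: card_gt_0_iff Suc_leI)
  hence "(-1 :: 'a) ^ (CARD('a) - 1) = -1" by simp
  hence "(1::'a) = -1" using finite_field_power_card_minus_1[of "-1::'a"] by simp
  hence "(2::'a) = 0" by (metis add.right_inverse one_add_one)
  thus False using two by blast
qed

text \<open>If \<open>q = 4 m + 1\<close>, an \<open>x\<close> with
  \<open>x^(2 m) \<noteq> 1\<close> has \<open>x^(2 m) = -1\<close>, which is a square. Otherwise
  \<open>(q - 1) / 2\<close> is odd, and raising \<open>y^2 = -1\<close> to that power would give
  \<open>1 = -1\<close>.\<close>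

lemma quad_char_minus_1:
  assumes two: "(2::'a::{field, finite}) \<noteq> 0"
  shows "quad_char (-1::'a) = (if CARD('a) mod 4 = 1 then 1 else -1)"
proof (cases "CARD('a) mod 4 = 1")
  case True
  define m where "m = CARD('a) div 4"
  have q: "CARD('a) - 1 = 4 * m" using True unfolding m_def by presburger
  have "m \<noteq> 0"
  proof
    assume "m = 0"
    thus False using card_ge_2[where ?'a = 'a] q by simp
  qed
  then obtain x :: 'a where x: "x \<noteq> 0" "x ^ (2 * m) \<noteq> 1"
    using exists_power_neq_1[where ?'a = 'a, of "2 * m"] q by auto
  have "(x ^ (2 * m))\<^sup>2 = 1"
    using finite_field_power_card_minus_1[OF x(1)] q by (simp flip: power_mult add: mult_ac)
  hence "x ^ (2 * m) = -1" using x(2) power2_eq_1_iff by blast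
  hence "(x ^ m)\<^sup>2 = -1" by (simp flip: power_mult add: mult_ac)
  thus ?thesis using True by (metis quad_char_eq_1_iff neg_equal_0_iff_equal one_neq_zero)
next
  case False
  define m where "m = CARD('a) div 4"
  have "CARD('a) mod 4 = 3" using False odd_card_if_two_neq_0[OF two] by presburger
  hence q: "CARD('a) - 1 = 2 * (2 * m + 1)" unfolding m_def by presburger
  have "y\<^sup>2 \<noteq> -1" for y :: 'a
  proof
    assume y: "y\<^sup>2 = -1"
    hence "y \<noteq> 0" by auto
    from finite_field_power_card_minus_1[OF this] have "(y\<^sup>2) ^ (2 * m + 1) = 1"
      unfolding q power_mult .
    hence "(1::'a) = -1" using y by simp
    hence "(2::'a) = 0" by (metis add.right_inverse one_add_one)
    thus False using two by blast
  qed
  thus ?thesis using False by (auto simp: quad_char_def dest: sym)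
qed

text \<open>\<open>-3 = (2 \<omega> + 1)\<^sup>2\<close> for a primitive cube root of unity \<open>\<omega>\<close>.\<close>

lemma quad_char_minus_3:
  assumes two: "(2::'a::{field, finite}) \<noteq> 0" and three: "(3::'a) \<noteq> 0"
    and q3: "\<not> 3 dvd CARD('a)"
  shows "quad_char (-3::'a) = (if CARD('a) mod 3 = 1 then 1 else -1)"
proof (cases "CARD('a) mod 3 = 1")
  case True
  define m where "m = CARD('a) div 3"
  have q: "CARD('a) - 1 = 3 * m" using True unfolding m_def by presburger
  have "m \<noteq> 0"
  proof
    assume "m = 0"
    thus False using card_ge_2[where ?'a = 'a] q by simp
  qed
  then obtain x :: 'a where x: "x \<noteq> 0" "x ^ m \<noteq> 1"
    using exists_power_neq_1[where ?'a = 'a, of m] q by auto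
  define w where "w = x ^ m"
  have "w ^ 3 = 1"
    using finite_field_power_card_minus_1[OF x(1)] q by (simp add: w_def mult.commute flip: power_mult)
  hence "(w - 1) * (w\<^sup>2 + w + 1) = 0" by algebra
  hence "w\<^sup>2 + w + 1 = 0" using x(2) by (simp add: w_def)
  hence "-3 = (2 * w + 1)\<^sup>2" by algebra
  thus ?thesis using True three quad_char_eq_1_iff[of "-3::'a"] by auto
next
  case False
  define m where "m = CARD('a) div 3"
  have q: "CARD('a) - 1 = 3 * m + 1" using False q3 unfolding m_def by presburger
  have "-3 \<noteq> y\<^sup>2" for y :: 'a
  proof
    assume y: "-3 = y\<^sup>2"
    define w where "w = (y - 1) / 2"
    have w: "2 * w = y - 1" using two by (simp add: w_def)
    have "4 * (w\<^sup>2 + w + 1) = 0" using y w by algebra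
    moreover have "(4::'a) \<noteq> 0" using two by (metis mult_eq_0_iff mult_2 numeral_Bit0)
    ultimately have w1: "w\<^sup>2 + w + 1 = 0" by (metis mult_eq_0_iff)
    hence w3: "w ^ 3 = 1" by algebra
    hence "w \<noteq> 0" by auto
    \<comment> \<open>Since \<open>q - 1\<close> is 1 modulo 3, a cube root of unity
      \<open>w\<close> must be 1; then \<open>w^2 + w + 1 = 0\<close> reads
      \<open>3 = 0\<close>.\<close>
    from finite_field_power_card_minus_1[OF this] have "(w ^ 3) ^ m * w = 1"
      unfolding q power_add power_mult by simp
    hence "w = 1" using w3 by simp
    thus False using w1 three by simp
  qed
  thus ?thesis using False three by (auto simp: quad_char_def)
qed

section \<open>Isomorphisms between members of the family\<close>

text \<open>
  An isomorphism \<open>E_D u \<rightarrow> E_D v\<close> with \<open>u \<noteq> v\<close> moves the origin to a 2-torsion point with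
  \<open>x\<close>-coordinate \<open>r \<noteq> 0\<close>. Writing \<open>r = 8 (z - 3)\<close>, the parameter \<open>z\<close> determines
  \<open>u = source z\<close> and \<open>v = target z\<close>, and \<open>cubic z = (2 z \<alpha>)\<^sup>2\<close>.
\<close>

definition cubic :: "'a::field \<Rightarrow> 'a" where
  "cubic z = z * (z + 1) * (z - 3)"

definition source :: "'a::field \<Rightarrow> 'a" where
  "source z = - 8 * (z - 3)\<^sup>2 / (z - 1)"

definition target :: "'a::field \<Rightarrow> 'a" where
  "target z = 64 * z\<^sup>2 / (z\<^sup>2 - 1)"

lemma pow2_neq_0:
  assumes "(2::'a::field) \<noteq> 0"
  shows "(4::'a) \<noteq> 0" "(8::'a) \<noteq> 0" "(16::'a) \<noteq> 0" "(32::'a) \<noteq> 0" "(64::'a) \<noteq> 0"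
proof -
  have "(2::'a) ^ n \<noteq> 0" for n using assms by simp
  from this[of 2] this[of 3] this[of 4] this[of 5] this[of 6]
  show "(4::'a) \<noteq> 0" "(8::'a) \<noteq> 0" "(16::'a) \<noteq> 0" "(32::'a) \<noteq> 0" "(64::'a) \<noteq> 0"
    by simp_all
qed

text \<open>As \<open>a1 = a3 = 0\<close> on both curves, \<open>s\<close> and \<open>t\<close>
  vanish outside characteristic 2. The last condition says that \<open>(r, 0)\<close> is a 2-torsion
  point.\<close>

lemma weierstrass_iso_E_D_iff_transform:
  assumes two: "(2::'a::field) \<noteq> 0"
  shows "weierstrass_iso (E_D u) (E_D (v::'a)) \<longleftrightarrow>
    (\<exists>\<alpha> r. \<alpha> \<noteq> 0 \<and> \<alpha>\<^sup>2 * v = u + 3 * r \<and> \<alpha> ^ 4 * (16 * v) = 16 * u + 2 * r * u + 3 * r\<^sup>2 \<and>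
      r * (16 * u + r * u + r\<^sup>2) = 0)" (is "?L \<longleftrightarrow> ?R")
proof
  assume ?L
  then obtain \<alpha> r s t where *: "\<alpha> \<noteq> 0" "\<alpha> * 0 = 0 + 2 * s"
      "\<alpha> ^ 2 * v = u - s * 0 + 3 * r - s ^ 2" "\<alpha> ^ 3 * 0 = 0 + r * 0 + 2 * t"
      "\<alpha> ^ 4 * (16 * v) = 16 * u - s * 0 + 2 * r * u - (t + r * s) * 0 + 3 * r ^ 2 - 2 * s * t"
      "\<alpha> ^ 6 * 0 = 0 + r * (16 * u) + r ^ 2 * u + r ^ 3 - t * 0 - t ^ 2 - r * t * 0"
    unfolding E_D_def weierstrass_iso_iff by blast
  have st: "s = 0" "t = 0" using *(2,4) two by auto
  have "r * (16 * u + r * u + r\<^sup>2) = 0" using *(6) st by algebra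
  thus ?R using * st by (intro exI[of _ \<alpha>] exI[of _ r]) simp
next
  assume ?R
  then obtain \<alpha> r where *: "\<alpha> \<noteq> 0" "\<alpha>\<^sup>2 * v = u + 3 * r"
    "\<alpha> ^ 4 * (16 * v) = 16 * u + 2 * r * u + 3 * r\<^sup>2" "r * (16 * u + r * u + r\<^sup>2) = 0" by blast
  have "0 = r * (16 * u) + r ^ 2 * u + r ^ 3" using *(4) by algebra
  thus ?L unfolding E_D_def weierstrass_iso_iff using *(1-3)
    by (intro exI[of _ \<alpha>] exI[of _ r] exI[of _ 0]) simp
qed

lemma weierstrass_iso_E_D_iff:
  assumes two: "(2::'a::field) \<noteq> 0" and u: "u \<noteq> 0" "u \<noteq> 64" and v: "v \<noteq> 0"
  shows "weierstrass_iso (E_D u) (E_D (v::'a)) \<longleftrightarrow>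
    u = v \<or> (\<exists>z. quad_char (cubic z) = 1 \<and> z \<noteq> 1 \<and> source z = u \<and> target z = v)"
  (is "_ \<longleftrightarrow> ?R")
proof
  note pow2 = pow2_neq_0[OF two]
  assume "weierstrass_iso (E_D u) (E_D v)"
  then obtain \<alpha> r where *: "\<alpha> \<noteq> 0" "\<alpha>\<^sup>2 * v = u + 3 * r"
    "\<alpha> ^ 4 * (16 * v) = 16 * u + 2 * r * u + 3 * r\<^sup>2" "r * (16 * u + r * u + r\<^sup>2) = 0"
    using weierstrass_iso_E_D_iff_transform[OF two] by blast
  show ?R
  proof (cases "r = 0")
    \<comment> \<open>With the origin fixed only a scaling remains, and \<open>u \<noteq> 0\<close>
      forces \<open>\<alpha>^2 = 1\<close>.\<close>
    case True
    hence "16 * u * (\<alpha>\<^sup>2 - 1) = 0" using *(2,3) by algebra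
    hence "\<alpha>\<^sup>2 = 1" using u pow2 by simp
    thus ?thesis using *(2) True by simp
  next
    case False
    define z where "z = r / 8 + 3"
    have r: "r = 8 * (z - 3)" using pow2 by (simp add: z_def)
    \<comment> \<open>Dividing by \<open>r\<close> leaves the quadratic for the nonzero 2-torsion
      abscissas; in terms of \<open>z\<close> it is linear in \<open>u\<close>.\<close>
    have "8 * (u * (z - 1) + 8 * (z - 3)\<^sup>2) = 0"
      using *(4) False unfolding r by algebra
    hence uz: "u * (z - 1) = - 8 * (z - 3)\<^sup>2" using pow2 by algebra
    have z3: "z \<noteq> 3" using False r by auto
    have z1: "z \<noteq> 1" using uz pow2 z3 by auto
    have "64 * (z - 3) * (4 * \<alpha>\<^sup>2 * z - (z - 3) * (z + 1)) = 0"
      using uz *(2,3) unfolding r by algebra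
    hence az: "4 * \<alpha>\<^sup>2 * z = (z - 3) * (z + 1)" using pow2 z3
      by (metis mult_eq_0_iff right_minus_eq)
    \<comment> \<open>Using \<open>az\<close> to eliminate \<open>\<alpha>^2\<close> expresses
      \<open>v\<close> through \<open>z\<close> alone.\<close>
    have "(z - 3) * (64 * z\<^sup>2) = 4 * z * (z - 1) * (u + 3 * r)"
      using uz unfolding r by algebra
    also have "\<dots> = 4 * \<alpha>\<^sup>2 * z * (v * (z - 1))" using *(2) by algebra
    also have "\<dots> = (z - 3) * (v * (z\<^sup>2 - 1))" unfolding az by algebra
    finally have vz: "v * (z\<^sup>2 - 1) = 64 * z\<^sup>2" using z3 by simp
    have z0: "z \<noteq> 0" using vz v by auto
    hence "z\<^sup>2 \<noteq> 1" using vz pow2 by auto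
    hence tgt: "target z = v" using vz by (simp add: target_def field_simps)
    have src: "source z = u" using uz z1 by (simp add: source_def field_simps)
    have "cubic z = (2 * z * \<alpha>)\<^sup>2" using az unfolding cubic_def by algebra
    moreover have "2 * z * \<alpha> \<noteq> 0" using two z0 *(1) by simp
    ultimately have "quad_char (cubic z) = 1" by (metis quad_char_square)
    thus ?thesis using z1 src tgt by blast
  qed
next
  note pow2 = pow2_neq_0[OF two]
  assume ?R
  thus "weierstrass_iso (E_D u) (E_D v)"
  proof
    assume "\<exists>z. quad_char (cubic z) = 1 \<and> z \<noteq> 1 \<and> source z = u \<and> target z = v"
    then obtain z y where z: "cubic z \<noteq> 0" "cubic z = y\<^sup>2" "z \<noteq> 1" "source z = u" "target z = v"
      unfolding quad_char_eq_1_iff by blast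
    have z0: "z \<noteq> 0" "z \<noteq> -1" "z \<noteq> 3" using z(1) by (auto simp: cubic_def)
    have "z\<^sup>2 \<noteq> 1" using z0 z(3) by (simp add: power2_eq_1_iff)
    hence vz: "v * (z\<^sup>2 - 1) = 64 * z\<^sup>2" using z(5) by (simp add: target_def field_simps)
    have uz: "u * (z - 1) = - 8 * (z - 3)\<^sup>2" using z(3,4) by (auto simp: source_def)
    \<comment> \<open>This inverts \<open>cubic z = (2 z \<alpha>)^2\<close>.\<close>
    define \<alpha> where "\<alpha> = y / (2 * z)"
    have a0: "\<alpha> \<noteq> 0" using z(1,2) z0 two by (auto simp: \<alpha>_def)
    have y: "y = 2 * z * \<alpha>" using z0 two by (simp add: \<alpha>_def)
    have "z * (4 * \<alpha>\<^sup>2 * z - (z - 3) * (z + 1)) = 0" using z(2) unfolding y cubic_def by algebra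
    hence az: "4 * \<alpha>\<^sup>2 * z = (z - 3) * (z + 1)" using z0 by simp
    define r where "r = 8 * (z - 3)"
    have nz: "4 * z * (z\<^sup>2 - 1) \<noteq> 0" "z - 1 \<noteq> 0" using pow2 z0 \<open>z\<^sup>2 \<noteq> 1\<close> z(3) by simp_all
    have "4 * z * (z\<^sup>2 - 1) * (\<alpha>\<^sup>2 * v) = 4 * \<alpha>\<^sup>2 * z * (v * (z\<^sup>2 - 1))" by algebra
    also have "\<dots> = (z - 3) * (z + 1) * (64 * z\<^sup>2)" unfolding az vz ..
    also have "\<dots> = 4 * z * (z\<^sup>2 - 1) * (u + 3 * r)" using uz unfolding r_def by algebra
    finally have 1: "\<alpha>\<^sup>2 * v = u + 3 * r" using nz(1) by (metis mult_left_cancel)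
    have "(z - 1) * (16 * \<alpha>\<^sup>2 * (u + 3 * r) - (16 * u + 2 * r * u + 3 * r\<^sup>2)) = 0"
      using az uz unfolding r_def by algebra
    hence "16 * \<alpha>\<^sup>2 * (u + 3 * r) = 16 * u + 2 * r * u + 3 * r\<^sup>2"
      using nz by (metis mult_eq_0_iff right_minus_eq)
    hence 2: "\<alpha> ^ 4 * (16 * v) = 16 * u + 2 * r * u + 3 * r\<^sup>2" using 1 by algebra
    have "(z - 1) * (16 * u + r * u + r\<^sup>2) = 0" using uz unfolding r_def by algebra
    hence "r * (16 * u + r * u + r\<^sup>2) = 0" using nz by simp
    thus ?thesis unfolding weierstrass_iso_E_D_iff_transform[OF two] using a0 1 2 by blast
  qed (simp add: weierstrass_iso_refl)
qed

text \<open>The values 0 and 64 would force \<open>z = 3\<close> and \<open>z = -1\<close>, which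
  are zeros of the cubic.\<close>

lemma source_in_family:
  assumes two: "(2::'a::field) \<noteq> 0" and z: "cubic z \<noteq> 0" "z \<noteq> 1"
  shows "source z \<noteq> (0::'a)" "source z \<noteq> 64"
proof -
  note pow2 = pow2_neq_0[OF two]
  have z': "z \<noteq> -1" "z \<noteq> 3" using z by (auto simp: cubic_def)
  have s: "source z * (z - 1) = - 8 * (z - 3)\<^sup>2" using z by (simp add: source_def)
  thus "source z \<noteq> 0" using pow2 z' by auto
  show "source z \<noteq> 64"
  proof
    assume "source z = 64"
    hence "64 * (z - 1) = - 8 * (z - 3)\<^sup>2" using s by simp
    hence "8 * (z + 1)\<^sup>2 = 0" by algebra
    thus False using pow2 z' by (simp add: add_eq_0_iff2)
  qed
qed

lemma target_in_family:
  assumes two: "(2::'a::field) \<noteq> 0" and z: "cubic z \<noteq> 0" "z \<noteq> 1"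
  shows "target z \<noteq> (0::'a)" "target z \<noteq> 64"
proof -
  note pow2 = pow2_neq_0[OF two]
  have z': "z \<noteq> -1" "z \<noteq> 0" using z by (auto simp: cubic_def)
  hence "z\<^sup>2 \<noteq> 1" using z by (simp add: power2_eq_1_iff)
  hence t: "target z * (z\<^sup>2 - 1) = 64 * z\<^sup>2" by (simp add: target_def)
  thus "target z \<noteq> 0" using pow2 z' by auto
  show "target z \<noteq> 64"
  proof
    assume "target z = 64"
    hence "64 * (z\<^sup>2 - 1) = 64 * z\<^sup>2" using t by simp
    hence "(64::'a) = 0" by (simp add: right_diff_distrib)
    thus False using pow2 by simp
  qed
qed

text \<open>Multiplied by \<open>z^2 - 1\<close>, the difference becomes
  \<open>8 (z + 3) (z^2 + 3)\<close>. Its roots lead from a curve to itself and so add nothing to a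
  class.\<close>

lemma target_eq_source_iff:
  assumes two: "(2::'a::field) \<noteq> 0" and z: "cubic z \<noteq> 0" "z \<noteq> 1"
  shows "target z = source z \<longleftrightarrow> z = (-3::'a) \<or> z\<^sup>2 = -3"
proof -
  note pow2 = pow2_neq_0[OF two]
  have z': "z \<noteq> -1" using z by (auto simp: cubic_def)
  hence z2: "z\<^sup>2 - 1 \<noteq> 0" using z by (simp add: power2_eq_1_iff)
  have t: "target z * (z\<^sup>2 - 1) = 64 * z\<^sup>2" using z2 by (simp add: target_def)
  have s: "source z * (z - 1) = - 8 * (z - 3)\<^sup>2" using z by (simp add: source_def)
  have "(target z - source z) * (z\<^sup>2 - 1) = 8 * ((z + 3) * (z\<^sup>2 + 3))" using s t by algebra
  hence "target z - source z = 0 \<longleftrightarrow> (z + 3) * (z\<^sup>2 + 3) = 0"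
    using z2 pow2 by (metis mult_eq_0_iff)
  thus ?thesis by (simp add: add_eq_0_iff2)
qed

lemma target_eq_iff:
  assumes two: "(2::'a::field) \<noteq> 0" and z: "z\<^sup>2 \<noteq> 1" and w: "w\<^sup>2 \<noteq> 1"
  shows "target z = target w \<longleftrightarrow> z = w \<or> z = - (w::'a)"
proof -
  have "z\<^sup>2 - 1 \<noteq> 0" "w\<^sup>2 - 1 \<noteq> 0" using z w by simp_all
  hence "target z = target w \<longleftrightarrow> 64 * z\<^sup>2 * (w\<^sup>2 - 1) = 64 * w\<^sup>2 * (z\<^sup>2 - 1)"
    by (simp add: target_def frac_eq_eq)
  also have "\<dots> \<longleftrightarrow> 64 * (z\<^sup>2 - w\<^sup>2) = 0" by algebra
  also have "\<dots> \<longleftrightarrow> z\<^sup>2 = w\<^sup>2" using pow2_neq_0[OF two] by simp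
  finally show ?thesis by (simp add: power2_eq_iff)
qed

text \<open>\<open>target\<close> identifies only \<open>z\<close> and \<open>-z\<close>; this keeps
  it injective on the fibres of \<open>source\<close> once \<open>z^2 = -3\<close> is
  excluded.\<close>

lemma source_uminus_eq_source:
  assumes two: "(2::'a::field) \<noteq> 0" and z: "z \<noteq> 0" "z \<noteq> 1" "z \<noteq> -1" "source (- z) = source z"
  shows "z\<^sup>2 = (-3 :: 'a)"
proof -
  have "source z * (z - 1) = - 8 * (z - 3)\<^sup>2" using z by (simp add: source_def)
  moreover have "- z - 1 \<noteq> 0" using z(3) by (metis add.inverse_inverse right_minus_eq)
  hence "source z * (- z - 1) = - 8 * (- z - 3)\<^sup>2"
    unfolding z(4)[symmetric] by (simp add: source_def)
  ultimately have "2 * 8 * z * (z\<^sup>2 + 3) = 0" by algebra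
  thus ?thesis using z two pow2_neq_0[OF two] by (simp add: add_eq_0_iff2)
qed

section \<open>The conjugate parameter\<close>

text \<open>The other 2-torsion point off the origin on the curve of parameter \<open>source z\<close>.\<close>

definition conj_param :: "'a::field \<Rightarrow> 'a" where
  "conj_param z = (z + 3) / (z - 1)"

lemma source_eq_iff:
  assumes two: "(2::'a::field) \<noteq> 0" and z: "z \<noteq> 1" "w \<noteq> (1::'a)"
  shows "source w = source z \<longleftrightarrow> w = z \<or> w = conj_param z"
proof -
  note pow2 = pow2_neq_0[OF two]
  have "source w = source z \<longleftrightarrow> - 8 * (w - 3)\<^sup>2 * (z - 1) = - 8 * (z - 3)\<^sup>2 * (w - 1)"
    using z by (simp add: source_def frac_eq_eq)
  also have "\<dots> \<longleftrightarrow> 8 * ((w - z) * (w * (z - 1) - (z + 3))) = 0" by algebra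
  also have "\<dots> \<longleftrightarrow> w = z \<or> w * (z - 1) = z + 3" using pow2 by auto
  also have "w * (z - 1) = z + 3 \<longleftrightarrow> w = conj_param z"
    using z by (auto simp: conj_param_def field_simps)
  finally show ?thesis .
qed

lemma conj_param_involution:
  assumes two: "(2::'a::field) \<noteq> 0" and z: "z \<noteq> (1::'a)"
  shows "conj_param z \<noteq> 1" "conj_param (conj_param z) = z"
proof -
  note pow2 = pow2_neq_0[OF two]
  have c: "conj_param z * (z - 1) = z + 3" using z by (simp add: conj_param_def)
  show 1: "conj_param z \<noteq> 1"
  proof
    assume "conj_param z = 1"
    hence "z - 1 = z + 3" using c by simp
    moreover have "(z + 3) - (z - 1) = 4" by simp
    ultimately have "(4::'a) = 0" by simp
    thus False using pow2 by simp
  qed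
  have "z * (conj_param z - 1) = conj_param z + 3" using c by algebra
  thus "conj_param (conj_param z) = z"
    using 1 by (subst conj_param_def) (simp add: field_simps)
qed

text \<open>A fixed point satisfies \<open>z^2 - 2 z - 3 = (z - 3) (z + 1) = 0\<close>, so it is a
  zero of the cubic.\<close>

lemma conj_param_neq:
  assumes z: "cubic z \<noteq> 0" "z \<noteq> 1"
  shows "conj_param z \<noteq> z"
proof
  assume "conj_param z = z"
  hence "z * (z - 1) = z + 3" using z by (simp add: conj_param_def field_simps)
  hence "cubic z = 0" unfolding cubic_def by algebra
  thus False using z by simp
qed

text \<open>Once \<open>cubic z\<close> is a nonzero square, the conjugate parameter passes the
  square test exactly when \<open>cubic (- z)\<close> is a nonzero square.\<close>

lemma cubic_conj_param:
  assumes "z \<noteq> 0" "z \<noteq> 1"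
  shows "cubic (conj_param z) = cubic z * cubic (- z) * (2 / (z * (z - 1)\<^sup>2))\<^sup>2"
proof -
  define c where "c = conj_param z"
  define k where "k = 2 / (z * (z - 1)\<^sup>2)"
  have c: "c * (z - 1) = z + 3" and k: "k * (z * (z - 1)\<^sup>2) = 2"
    using assms by (auto simp: c_def k_def conj_param_def)
  \<comment> \<open>The prefactor clears denominators, leaving an identity that follows from the
    polynomial relations \<open>c\<close> and \<open>k\<close>.\<close>
  have "z\<^sup>2 * (z - 1) ^ 4 * cubic c = z\<^sup>2 * (z - 1) ^ 4 * (cubic z * cubic (- z) * k\<^sup>2)"
    using c k unfolding cubic_def by algebra
  thus ?thesis using assms by (simp add: c_def k_def)
qed

section \<open>Class sizes and the number of classes\<close>

text \<open>The parameters \<open>z = -3\<close> and \<open>z\<^sup>2 = -3\<close> are the extra automorphisms at \<open>j = 1728\<close> and \<open>j = 0\<close>.\<close>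

definition hops :: "'a::field set" where
  "hops = {z. quad_char (cubic z) = 1 \<and> z \<noteq> 1 \<and> z \<noteq> -3 \<and> z\<^sup>2 \<noteq> -3}"

lemma hopsD:
  assumes "z \<in> hops"
  shows "cubic z \<noteq> 0" "z \<noteq> 1" "z \<noteq> 0" "z \<noteq> -1" "z \<noteq> 3" "z\<^sup>2 \<noteq> 1" "z \<noteq> -3" "z\<^sup>2 \<noteq> -3"
proof -
  show c: "cubic z \<noteq> 0" using assms by (auto simp: hops_def)
  show "z \<noteq> 1" "z \<noteq> -3" "z\<^sup>2 \<noteq> -3" using assms by (auto simp: hops_def)
  show "z \<noteq> 0" "z \<noteq> -1" "z \<noteq> 3" using c by (auto simp: cubic_def)
  thus "z\<^sup>2 \<noteq> 1" using \<open>z \<noteq> 1\<close> by (simp add: power2_eq_1_iff)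
qed

text \<open>Besides \<open>u\<close> itself, the class consists of the targets of the parameters
  with source \<open>u\<close>; these are pairwise distinct and differ from
  \<open>u\<close>.\<close>

lemma card_iso_class_E_D:
  assumes two: "(2::'a::{field, finite}) \<noteq> 0" and u: "u \<noteq> 0" "u \<noteq> (64::'a)"
  shows "card {v. v \<noteq> 0 \<and> v \<noteq> 64 \<and> weierstrass_iso (E_D u) (E_D v)} =
    Suc (card {z \<in> hops. source z = u})"
proof -
  let ?G = "{z \<in> hops. source z = u}"
  have "{v. v \<noteq> 0 \<and> v \<noteq> 64 \<and> weierstrass_iso (E_D u) (E_D v)} = insert u (target ` ?G)"
  proof (intro equalityI subsetI)
    fix v assume "v \<in> {v. v \<noteq> 0 \<and> v \<noteq> 64 \<and> weierstrass_iso (E_D u) (E_D v)}"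
    hence v: "v \<noteq> 0" "weierstrass_iso (E_D u) (E_D v)" by auto
    show "v \<in> insert u (target ` ?G)"
    proof (cases "u = v")
      case False
      then obtain z where z: "quad_char (cubic z) = 1" "z \<noteq> 1" "source z = u" "target z = v"
        using weierstrass_iso_E_D_iff[OF two u v(1)] v(2) by blast
      moreover have "z \<noteq> -3 \<and> z\<^sup>2 \<noteq> -3"
        using False z target_eq_source_iff[OF two _ z(2)] by (metis quad_char_eq_1_iff)
      ultimately have "z \<in> hops" by (simp add: hops_def)
      thus ?thesis using z by blast
    qed simp
  next
    fix v assume "v \<in> insert u (target ` ?G)"
    then consider "v = u" | z where "z \<in> hops" "source z = u" "target z = v" by blast
    thus "v \<in> {v. v \<noteq> 0 \<and> v \<noteq> 64 \<and> weierstrass_iso (E_D u) (E_D v)}"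
    proof cases
      case 1
      thus ?thesis using u by (simp add: weierstrass_iso_refl)
    next
      case (2 z)
      have v: "v \<noteq> 0" "v \<noteq> 64"
        using target_in_family[OF two hopsD(1,2)[OF 2(1)]] 2 by auto
      moreover have "quad_char (cubic z) = 1" "z \<noteq> 1" using 2(1) by (auto simp: hops_def)
      ultimately show ?thesis using weierstrass_iso_E_D_iff[OF two u v(1)] 2 by blast
    qed
  qed
  moreover have "u \<notin> target ` ?G"
  proof
    assume "u \<in> target ` ?G"
    then obtain z where "u = target z" "z \<in> hops" "source z = u" by blast
    hence z: "z \<in> hops" "target z = source z" by simp_all
    show False using target_eq_source_iff[OF two hopsD(1,2)[OF z(1)]] hopsD(7,8)[OF z(1)] z(2) by simp
  qed
  moreover have "inj_on target ?G"
  proof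
    fix z w assume zw: "z \<in> ?G" "w \<in> ?G" "target z = target w"
    hence hops: "z \<in> hops" "w \<in> hops" by auto
    hence "z = w \<or> z = - w"
      using target_eq_iff[OF two hopsD(6) hopsD(6)] zw(3) by blast
    moreover have "z \<noteq> - w"
    proof
      assume "z = - w"
      hence "source (- w) = source w" using zw by simp
      thus False
        using source_uminus_eq_source[OF two] hopsD(2-4,8)[OF hops(2)] by blast
    qed
    ultimately show "z = w" by blast
  qed
  ultimately show ?thesis by (simp add: card_image)
qed

text \<open>The square test is \<open>cubic_conj_param\<close>. The remaining exclusions hold
  automatically: \<open>c = -3\<close> would mean \<open>z = 0\<close>, and \<open>c^2 = -3\<close>
  would mean \<open>z^2 = -3\<close>.\<close>

lemma conj_param_in_hops_iff:
  assumes two: "(2::'a::{field, finite}) \<noteq> 0" and z: "z \<in> hops"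
  shows "conj_param z \<in> hops \<longleftrightarrow> quad_char (cubic (- z :: 'a)) = 1"
proof -
  note h = hopsD[OF z] and pow2 = pow2_neq_0[OF two]
  define c where "c = conj_param z"
  have c: "c * (z - 1) = z + 3" using h by (simp add: c_def conj_param_def)
  have "quad_char (cubic c) = quad_char (cubic z) * quad_char (cubic (- z))"
    using quad_char_mult_square[of "2 / (z * (z - 1)\<^sup>2)" "cubic z * cubic (- z)"] h two
    by (simp add: c_def cubic_conj_param quad_char_mult[OF two])
  hence "quad_char (cubic c) = quad_char (cubic (- z))" using z by (simp add: hops_def)
  moreover have "c \<noteq> 1" using conj_param_involution[OF two h(2)] by (simp add: c_def)
  moreover have "c \<noteq> -3"
  proof
    assume "c = -3"
    hence "-3 * (z - 1) = z + 3" using c by simp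
    hence "4 * z = 0" by algebra
    thus False using h pow2 by simp
  qed
  moreover have "c\<^sup>2 \<noteq> -3"
  proof
    assume "c\<^sup>2 = -3"
    hence "4 * (z\<^sup>2 + 3) = 0" using c by algebra
    hence "z\<^sup>2 + 3 = 0" using pow2 by (metis mult_eq_0_iff)
    thus False using h by (simp add: add_eq_0_iff2)
  qed
  ultimately show ?thesis by (simp add: hops_def c_def)
qed

text \<open>A fibre lies in a conjugate pair, so \<open>g \<le> 2\<close>. The second set contains
  both members of the pair when \<open>g = 2\<close> and is empty otherwise, so its size is
  \<open>g (g - 1)\<close>.\<close>

lemma card_hops_fibre:
  fixes u :: "'a::{field, finite}"
  assumes two: "(2::'a) \<noteq> 0"
  defines "g \<equiv> card {z \<in> hops. source z = u}"
  shows "1 / real (Suc g) = 1 - real g / 2 +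
    real (card {z \<in> hops. quad_char (cubic (- z)) = 1 \<and> source z = u}) / 6"
proof (cases "{z \<in> hops. source z = u} = {}")
  case True
  hence "{z \<in> hops. quad_char (cubic (- z)) = 1 \<and> source z = u} = {}" by auto
  thus ?thesis unfolding g_def True by simp
next
  case False
  then obtain z where z: "z \<in> hops" "source z = u" by blast
  define c where "c = conj_param z"
  note h = hopsD[OF z(1)]
  have c: "c \<noteq> z" "conj_param c = z" "c \<noteq> 1"
    using conj_param_neq h(1,2) conj_param_involution[OF two h(2)] by (auto simp: c_def)
  have fibre: "{w \<in> hops. source w = u} = {z, c} \<inter> hops"
    using source_eq_iff[OF two h(2)] hopsD(2) c(3) z by (auto simp: c_def)
  have "{w \<in> hops. quad_char (cubic (- w)) = 1 \<and> source w = u} =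
      {w \<in> {z, c} \<inter> hops. conj_param w \<in> hops}"
    using fibre conj_param_in_hops_iff[OF two] by blast
  also have "\<dots> = (if c \<in> hops then {z, c} else {})"
  proof (rule set_eqI)
    fix w
    have "conj_param z = c" by (simp add: c_def)
    thus "w \<in> {w \<in> {z, c} \<inter> hops. conj_param w \<in> hops} \<longleftrightarrow>
        w \<in> (if c \<in> hops then {z, c} else {})"
      using z(1) c(2) by (cases "w = z"; cases "w = c") simp_all
  qed
  finally have both: "{w \<in> hops. quad_char (cubic (- w)) = 1 \<and> source w = u} =
      (if c \<in> hops then {z, c} else {})" .
  show ?thesis
    using c(1) z(1) unfolding g_def fibre both by (cases "c \<in> hops") (auto simp: Int_insert_left)
qed

lemma I_D_eq:
  assumes two: "(2::'a::{field, finite}) \<noteq> 0"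
  shows "real (I_D TYPE('a)) = real (CARD('a)) - 2 - real (card (hops :: 'a set)) / 2 +
    real (card {z \<in> (hops :: 'a set). quad_char (cubic (- z)) = 1}) / 6"
proof -
  let ?U = "{u::'a. u \<noteq> 0 \<and> u \<noteq> 64}"
  let ?r = "{(E, E'). E \<in> family_D \<and> E' \<in> family_D \<and> weierstrass_iso E (E' :: 'a weierstrass)}"
  have inj: "inj (E_D :: 'a \<Rightarrow> _)" by (auto simp: inj_def E_D_def)
  have "?r `` {E_D u} = E_D ` {v. v \<noteq> 0 \<and> v \<noteq> 64 \<and> weierstrass_iso (E_D u) (E_D v)}"
    if "u \<in> ?U" for u
    using that by (auto simp: family_D_def)
  hence class_card: "card (?r `` {E_D u}) = Suc (card {z \<in> hops. source z = u})"
    if "u \<in> ?U" for u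
    using that card_iso_class_E_D[OF two, of u] card_image[OF inj_on_subset[OF inj subset_UNIV]] by simp
  have fibres: "(\<Sum>u\<in>?U. card {z \<in> S. source z = u}) = card S"
    if S: "S \<subseteq> hops" for S
  proof -
    \<comment> \<open>No parameter has its source outside the family, so the fibres over
      \<open>?U\<close> exhaust \<open>S\<close>.\<close>
    have "source ` S \<subseteq> ?U"
    proof
      fix u assume "u \<in> source ` S"
      then obtain z where "z \<in> hops" "u = source z" using S by blast
      thus "u \<in> ?U" using source_in_family[OF two hopsD(1,2)] by simp
    qed
    thus ?thesis using sum.group[of S ?U source "\<lambda>_. 1::nat"] by simp
  qed
  have "finite (family_D :: 'a weierstrass set)" by (simp add: family_D_def)
  hence "real (I_D TYPE('a)) = (\<Sum>E\<in>family_D. 1 / real (card (?r `` {E})))"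
    unfolding I_D_def iso_classes_D_def by (rule card_quotient_eq_sum_inverse) (rule equiv_family_D)
  also have "\<dots> = (\<Sum>u\<in>?U. 1 / real (card (?r `` {E_D u})))"
    unfolding family_D_def by (subst sum.reindex) (use inj in \<open>auto intro: inj_on_subset\<close>)
  also have "\<dots> = (\<Sum>u\<in>?U. 1 - real (card {z \<in> hops. source z = u}) / 2 +
      real (card {z \<in> {z \<in> hops. quad_char (cubic (- z)) = 1}. source z = u}) / 6)"
  proof (intro sum.cong refl)
    fix u assume u: "u \<in> ?U"
    show "1 / real (card (?r `` {E_D u})) = 1 - real (card {z \<in> hops. source z = u}) / 2 +
      real (card {z \<in> {z \<in> hops. quad_char (cubic (- z)) = 1}. source z = u}) / 6"
      unfolding class_card[OF u] card_hops_fibre[OF two] by simp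
  qed
  also have "\<dots> = real (card ?U) - real (\<Sum>u\<in>?U. card {z \<in> hops. source z = u}) / 2 +
      real (\<Sum>u\<in>?U. card {z \<in> {z \<in> hops. quad_char (cubic (- z)) = 1}. source z = u}) / 6"
    by (simp add: sum.distrib sum_subtractf flip: sum_divide_distrib)
  also have "(\<Sum>u\<in>?U. card {z \<in> hops. source z = u}) = card (hops :: 'a set)"
    by (rule fibres) simp
  also have "(\<Sum>u\<in>?U. card {z \<in> {z \<in> hops. quad_char (cubic (- z)) = 1}. source z = u}) =
      card {z \<in> (hops :: 'a set). quad_char (cubic (- z)) = 1}"
    by (rule fibres) auto
  also have "?U = UNIV - {0, 64}" by auto
  hence "real (card ?U) = real (CARD('a)) - 2"
    using pow2_neq_0[OF two] card_ge_2[where ?'a = 'a] by (simp add: card_Diff_subset of_nat_diff)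
  finally show ?thesis .
qed

section \<open>Counting by character sums\<close>

lemma real_card_Collect: "real (card {z::'a::finite. P z}) = (\<Sum>z\<in>UNIV. of_bool (P z))"
  by simp

text \<open>\<open>1 + quad_char\<close> is twice the indicator of the nonzero squares plus the
  indicator of 0.\<close>

lemma card_quad_char_eq_1:
  fixes f :: "'b::finite \<Rightarrow> 'a::field"
  shows "2 * real (card {z. quad_char (f z) = 1}) =
    (\<Sum>z\<in>UNIV. quad_char (f z)) + real (CARD('b)) - real (card {z. f z = 0})"
proof -
  have "(\<Sum>z\<in>UNIV. 1 + quad_char (f z)) =
      (\<Sum>z\<in>UNIV. 2 * of_bool (quad_char (f z) = 1) + of_bool (f z = 0))"
    by (intro sum.cong refl) (auto simp: quad_char_def)
  also have "\<dots> = 2 * real (card {z. quad_char (f z) = 1}) + real (card {z. f z = 0})"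
    unfolding real_card_Collect by (simp only: sum.distrib sum_distrib_left)
  finally show ?thesis by (simp add: sum.distrib)
qed

text \<open>Away from zeros of \<open>f\<close> and \<open>g\<close>, the product
  \<open>(1 + quad_char (f z)) * (1 + quad_char (g z))\<close> is 4 times the indicator; the last
  sum removes what the zeros contribute.\<close>

lemma card_quad_char_eq_1_both:
  fixes f g :: "'b::finite \<Rightarrow> 'a::{field, finite}"
  assumes two: "(2::'a) \<noteq> 0"
  shows "4 * real (card {z. quad_char (f z) = 1 \<and> quad_char (g z) = 1}) =
    real (CARD('b)) + (\<Sum>z\<in>UNIV. quad_char (f z)) + (\<Sum>z\<in>UNIV. quad_char (g z)) +
    (\<Sum>z\<in>UNIV. quad_char (f z * g z)) -
    (\<Sum>z | f z * g z = 0. (1 + quad_char (f z)) * (1 + quad_char (g z)))"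
proof -
  let ?h = "\<lambda>z. (1 + quad_char (f z)) * (1 + quad_char (g z))"
  have "(\<Sum>z\<in>UNIV. ?h z) = (\<Sum>z\<in>UNIV. 4 * of_bool (quad_char (f z) = 1 \<and> quad_char (g z) = 1) +
      (if f z * g z = 0 then ?h z else 0))"
    by (intro sum.cong refl) (auto simp: quad_char_def)
  also have "\<dots> = 4 * real (card {z. quad_char (f z) = 1 \<and> quad_char (g z) = 1}) +
      (\<Sum>z | f z * g z = 0. ?h z)"
    using sum.inter_filter[of UNIV ?h "\<lambda>z. f z * g z = 0"]
    unfolding real_card_Collect by (simp only: sum.distrib sum_distrib_left finite UNIV_I simp_thms)
  also have "(\<Sum>z\<in>UNIV. ?h z) = real (CARD('b)) + (\<Sum>z\<in>UNIV. quad_char (f z)) +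
      (\<Sum>z\<in>UNIV. quad_char (g z)) + (\<Sum>z\<in>UNIV. quad_char (f z * g z))"
    by (simp add: quad_char_mult[OF two] algebra_simps sum.distrib)
  finally show ?thesis by simp
qed

definition cubic_sum :: "'a::{field, finite} itself \<Rightarrow> real" where
  "cubic_sum _ = (\<Sum>z\<in>(UNIV::'a set). quad_char (cubic z))"

text \<open>The leading 1 is the point at infinity. The substitution \<open>z = 4 x + 3\<close>
  multiplies the right-hand side of \<open>L\<close> by \<open>64 = 8^2\<close>, which the character
  ignores.\<close>

lemma card_rational_points_curve_L:
  assumes two: "(2::'a::{field, finite}) \<noteq> 0"
  shows "real (card (rational_points (curve_L :: 'a weierstrass))) =
    1 + real (CARD('a)) + cubic_sum TYPE('a)"
proof -
  note pow2 = pow2_neq_0[OF two]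
  let ?h = "\<lambda>x::'a. x * (x + 1) * (x + 3 / 4)"
  have h: "quad_char (?h x) = quad_char (cubic (4 * x + 3))" for x
  proof -
    have "cubic (4 * x + 3) = ?h x * 8\<^sup>2"
    proof -
      define c :: 'a where "c = 3 / 4"
      have "4 * c = 3" using pow2 by (simp add: c_def)
      hence eqs: "4 * x + 3 = 4 * (x + c)" "4 * (x + c) + 1 = 4 * (x + 1)" "4 * (x + c) - 3 = 4 * x"
        by (simp_all add: distrib_left)
      have "(8::'a)\<^sup>2 = 4 * 4 * 4" by simp
      thus ?thesis unfolding cubic_def c_def[symmetric] eqs by (simp only: mult_ac)
    qed
    thus ?thesis using quad_char_mult_square[of "8::'a"] pow2 by metis
  qed
  have "{(x, y). weierstrass_expr id (curve_L :: 'a weierstrass) x y = 0} =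
      Sigma UNIV (\<lambda>x. {y. y\<^sup>2 = ?h x})"
    by (auto simp: weierstrass_expr_curve_L)
  hence "real (card (rational_points (curve_L :: 'a weierstrass))) =
      1 + (\<Sum>x\<in>UNIV. real (card {y. y\<^sup>2 = ?h x}))"
    unfolding rational_points_def by (subst card_insert_disjoint) (auto simp: card_image)
  also have "\<dots> = 1 + real (CARD('a)) + (\<Sum>x\<in>UNIV. quad_char (cubic (4 * x + 3 :: 'a)))"
    by (simp only: card_square_roots[OF two] h sum.distrib) simp
  also have "(\<Sum>x\<in>UNIV. quad_char (cubic (4 * x + 3 :: 'a))) = cubic_sum TYPE('a)"
  proof -
    have "bij_betw (\<lambda>x::'a. 4 * x + 3) UNIV UNIV"
      by (rule bij_betw_byWitness[of _ "\<lambda>z. (z - 3) / 4"])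
        (use pow2 in \<open>auto simp del: right_diff_distrib_numeral\<close>)
    thus ?thesis unfolding cubic_sum_def by (rule sum.reindex_bij_betw)
  qed
  finally show ?thesis .
qed

lemma cubic_uminus: "cubic (- z) = - (z * (z - 1) * (z + 3))"
  unfolding cubic_def by algebra

lemma quad_char_cubic_1:
  assumes two: "(2::'a::{field, finite}) \<noteq> 0"
  shows "quad_char (cubic (1::'a)) = quad_char (-1 :: 'a)"
proof -
  have "cubic (1::'a) = -1 * 2\<^sup>2" by (simp add: cubic_def)
  thus ?thesis using quad_char_mult_square[OF two] by metis
qed

lemma quad_char_cubic_minus_3:
  assumes two: "(2::'a::{field, finite}) \<noteq> 0" and three: "(3::'a) \<noteq> 0"
  shows "quad_char (cubic (-3::'a)) = quad_char (-1 :: 'a)"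
proof -
  have "cubic (-3::'a) = -1 * (2 * 3)\<^sup>2" by (simp add: cubic_def)
  moreover have "2 * 3 \<noteq> (0::'a)" using two three by (metis mult_eq_0_iff)
  ultimately show ?thesis using quad_char_mult_square by metis
qed

lemma sum_quad_char_cubic_uminus:
  "(\<Sum>z\<in>UNIV. quad_char (cubic (- z :: 'a))) = cubic_sum TYPE('a::{field, finite})"
proof -
  have "bij_betw (uminus :: 'a \<Rightarrow> 'a) UNIV UNIV"
    by (rule bij_betw_byWitness[of _ uminus]) auto
  thus ?thesis unfolding cubic_sum_def by (rule sum.reindex_bij_betw)
qed

text \<open>
  By \<open>cubic_conj_param\<close> the product is, up to squares, the cubic at \<open>conj_param z\<close>, and
  \<open>conj_param\<close> permutes the parameters other than \<open>1\<close>; the excluded values account for the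
  correction terms.
\<close>

lemma sum_quad_char_cubic_mult:
  assumes two: "(2::'a::{field, finite}) \<noteq> 0"
  shows "(\<Sum>z\<in>UNIV. quad_char (cubic z * cubic (- z :: 'a))) =
    cubic_sum TYPE('a) - quad_char (cubic (1::'a)) - quad_char (cubic (-3::'a))"
proof -
  \<comment> \<open>\<open>cubic_conj_param\<close> divides by \<open>z\<close> and
    \<open>z - 1\<close>. Under \<open>conj_param\<close> the value 0 corresponds to -3, hence the
    shape of \<open>?B\<close>.\<close>
  let ?A = "UNIV - {0, 1 :: 'a}" and ?B = "UNIV - {-3, 1 :: 'a}"
  have ne: "(-3::'a) \<noteq> 1"
  proof
    assume "(-3::'a) = 1"
    hence "1 - (-3::'a) = 0" by simp
    hence "(4::'a) = 0" by simp
    thus False using pow2_neq_0[OF two] by simp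
  qed
  have conj0: "conj_param z = -3 \<longleftrightarrow> z = 0" if "z \<noteq> (1::'a)" for z
  proof -
    have "conj_param (0::'a) = -3" by (simp add: conj_param_def)
    thus ?thesis using conj_param_involution(2)[OF two] that
      by (metis zero_neq_one)
  qed
  have "bij_betw conj_param ?A ?B"
    by (rule bij_betw_byWitness[of _ conj_param])
      (use conj_param_involution[OF two] conj0 in \<open>auto, metis+\<close>)
  hence "(\<Sum>z\<in>?A. quad_char (cubic (conj_param z))) = (\<Sum>z\<in>?B. quad_char (cubic z))"
    by (rule sum.reindex_bij_betw)
  moreover have "quad_char (cubic (conj_param z)) = quad_char (cubic z * cubic (- z))"
    if "z \<in> ?A" for z
    using that two quad_char_mult_square[of "2 / (z * (z - 1)\<^sup>2)"] by (simp add: cubic_conj_param)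
  ultimately have "(\<Sum>z\<in>?A. quad_char (cubic z * cubic (- z))) = (\<Sum>z\<in>?B. quad_char (cubic z))"
    by simp
  moreover have "(\<Sum>z\<in>?A. quad_char (cubic z * cubic (- z))) =
      (\<Sum>z\<in>UNIV. quad_char (cubic z * cubic (- z :: 'a)))"
    by (rule sum.mono_neutral_left) (auto simp: cubic_def)
  moreover have "(\<Sum>z\<in>?B. quad_char (cubic z)) =
      cubic_sum TYPE('a) - quad_char (cubic (1::'a)) - quad_char (cubic (-3::'a))"
    using ne by (subst sum_diff) (auto simp: cubic_sum_def)
  ultimately show ?thesis by simp
qed

section \<open>The two parameter counts, by characteristic\<close>

text \<open>The condition \<open>quad_char (cubic z) = 1\<close> also admits \<open>1\<close> and
  \<open>-3\<close> when \<open>-1\<close> is a square, and every root of \<open>z^2 = -3\<close>.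
  Removing them subtracts \<open>1 + e\<close> and \<open>1 + d\<close>. In the second count
  \<open>1\<close> and \<open>-3\<close> never occur, since \<open>-1\<close> and \<open>3\<close>
  are zeros of the cubic.\<close>

lemma card_hops_char_neq_3:
  assumes two: "(2::'a::{field, finite}) \<noteq> 0" and three: "(3::'a) \<noteq> 0"
  defines "e \<equiv> quad_char (-1 :: 'a)" and "d \<equiv> quad_char (-3 :: 'a)"
  shows "real (card (hops :: 'a set)) =
      (real (CARD('a)) - 3 + cubic_sum TYPE('a)) / 2 - (1 + e) - (1 + d)" (is ?thesis1)
    and "real (card {z \<in> (hops :: 'a set). quad_char (cubic (- z)) = 1}) =
      (real (CARD('a)) + 3 * cubic_sum TYPE('a) - 5 - 6 * e) / 4 - (1 + d)" (is ?thesis2)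
proof -
  note pow2 = pow2_neq_0[OF two]
  have six: "(6::'a) \<noteq> 0" "(12::'a) \<noteq> 0"
  proof -
    have "(2::'a) * 3 \<noteq> 0" "(4::'a) * 3 \<noteq> 0" using two three pow2 by (metis mult_eq_0_iff)+
    thus "(6::'a) \<noteq> 0" "(12::'a) \<noteq> 0" by simp_all
  qed
  have neqI: "a \<noteq> b" if "a - b = c" "c \<noteq> 0" for a b c :: 'a using that by auto
  have neq: "(1::'a) \<noteq> -1" "(3::'a) \<noteq> 1" "(1::'a) \<noteq> -3" "(3::'a) \<noteq> -3" "(3::'a) \<noteq> -1"
    "(-1::'a) \<noteq> -3" "(9::'a) \<noteq> -3"
    by (rule neqI[of _ _ 2] neqI[of _ _ 4] neqI[of _ _ 6] neqI[of _ _ 12],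
      simp, use two pow2 six in simp)+
  let ?W = "{z::'a. z\<^sup>2 = -3}"
  have W: "quad_char (cubic z) = 1" "-z \<in> ?W" if "z \<in> ?W" for z
  proof -
    have z2: "z\<^sup>2 = -3" using that by simp
    have "z \<noteq> 0" using z2 three by auto
    show "-z \<in> ?W" using z2 by simp
    \<comment> \<open>\<open>w\<close> is a primitive cube root of unity; with
      \<open>z = 2 w + 1\<close> the cubic becomes an explicit square.\<close>
    define w where "w = (z - 1) / 2"
    have w: "2 * w = z - 1" using two by (simp add: w_def)
    have "4 * (w\<^sup>2 + w + 1) = 0" using w z2 by algebra
    hence "w\<^sup>2 + w + 1 = 0" using pow2 by (metis mult_eq_0_iff)
    hence "cubic z = (2 * z * w\<^sup>2)\<^sup>2" using w z2 unfolding cubic_def by algebra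
    moreover have "w \<noteq> 0" using \<open>w\<^sup>2 + w + 1 = 0\<close> by auto
    hence "2 * z * w\<^sup>2 \<noteq> 0" using two \<open>z \<noteq> 0\<close> by simp
    ultimately show "quad_char (cubic z) = 1" by (metis quad_char_square)
  qed
  have cW: "real (card ?W) = 1 + d" unfolding d_def by (rule card_square_roots[OF two])
  have e1: "quad_char (cubic (1::'a)) = e" "quad_char (cubic (-3::'a)) = e"
    using quad_char_cubic_1[OF two] quad_char_cubic_minus_3[OF two three] by (simp_all add: e_def)
  have e: "e = 1 \<or> e = -1" unfolding e_def by (rule quad_char_cases) simp
  have "{z::'a. cubic z = 0} = {0, -1, 3}" by (auto simp: cubic_def add_eq_0_iff2)
  hence A: "2 * real (card {z::'a. quad_char (cubic z) = 1}) = cubic_sum TYPE('a) + real (CARD('a)) - 3"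
    using card_quad_char_eq_1[of "cubic :: 'a \<Rightarrow> 'a"] neq neq[symmetric] three by (simp add: cubic_sum_def)
  define X where "X = (if e = 1 then {1, -3 :: 'a} else {})"
  have "{z::'a. quad_char (cubic z) = 1} = hops \<union> X \<union> ?W"
    using W(1) e1 unfolding X_def hops_def by auto
  moreover have "hops \<inter> X = {}" by (auto simp: X_def hops_def)
  moreover have "(hops \<union> X) \<inter> ?W = {}"
    using neq(3,7) by (auto simp: X_def hops_def split: if_splits)
  ultimately have "card {z::'a. quad_char (cubic z) = 1} = card (hops :: 'a set) + card X + card ?W"
    by (simp only: card_Un_disjoint finite)
  moreover have "real (card X) = 1 + e" using e neq(3) by (auto simp: X_def)
  ultimately show ?thesis1 using A cW by (simp add: field_simps)
  let ?B = "{z::'a. quad_char (cubic z) = 1 \<and> quad_char (cubic (- z)) = 1}"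
  have zeros: "{z::'a. cubic z * cubic (- z) = 0} = {0, 1, -1, 3, -3}"
    unfolding cubic_uminus by (auto simp: cubic_def add_eq_0_iff2)
  have e2: "cubic (-1::'a) = 0" "cubic (3::'a) = 0" "cubic (0::'a) = 0" by (simp_all add: cubic_def)
  \<comment> \<open>The zero \<open>z = 0\<close> contributes 1; at each of the four others one
    factor is 1 and the other is \<open>1 + e\<close>.\<close>
  have "(\<Sum>z | cubic z * cubic (- z :: 'a) = 0. (1 + quad_char (cubic z)) * (1 + quad_char (cubic (- z)))) =
      1 + 4 * (1 + e)"
    unfolding zeros using neq neq[symmetric] three by (simp add: e1 e2 del: mult_eq_0_iff)
  hence "4 * real (card ?B) = real (CARD('a)) + 3 * cubic_sum TYPE('a) - 5 - 6 * e"
    using card_quad_char_eq_1_both[OF two, of cubic "\<lambda>z. cubic (- z)"]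
      sum_quad_char_cubic_uminus[where ?'a = 'a] sum_quad_char_cubic_mult[OF two]
    by (simp add: e1 flip: cubic_sum_def)
  moreover have "?B = {z \<in> hops. quad_char (cubic (- z)) = 1} \<union> ?W"
  proof (intro set_eqI iffI)
    fix z assume z: "z \<in> ?B"
    have "z \<noteq> 1" "z \<noteq> -3" using z e2 by auto
    thus "z \<in> {z \<in> hops. quad_char (cubic (- z)) = 1} \<union> ?W" using z by (simp add: hops_def)
  next
    fix z assume "z \<in> {z \<in> hops. quad_char (cubic (- z)) = 1} \<union> ?W"
    thus "z \<in> ?B" using W(1)[of z] W(1)[OF W(2), of z] by (auto simp: hops_def)
  qed
  hence "card ?B = card {z \<in> (hops :: 'a set). quad_char (cubic (- z)) = 1} + card ?W"
    by (simp only: finite) (rule card_Un_disjoint, auto simp: hops_def)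
  ultimately show ?thesis2 using cW by (simp add: field_simps)
qed

text \<open>Here the cubic degenerates to \<open>z^2 (z + 1)\<close>, so its character sum is
  elementary. Both \<open>z = -3\<close> and \<open>z^2 = -3\<close> now mean \<open>z = 0\<close>,
  a zero of the cubic, so only \<open>z = 1\<close> has to be removed.\<close>

lemma card_hops_char_3:
  assumes two: "(2::'a::{field, finite}) \<noteq> 0" and three: "(3::'a) = 0"
  defines "e \<equiv> quad_char (-1 :: 'a)"
  shows "real (card (hops :: 'a set)) = (real (CARD('a)) - 3) / 2 - (1 + e) / 2" (is ?thesis1)
    and "real (card {z \<in> (hops :: 'a set). quad_char (cubic (- z)) = 1}) =
      (real (CARD('a)) - 6 - 3 * e) / 4" (is ?thesis2)
proof -
  have cubic: "cubic z = z\<^sup>2 * (z + 1)" for z :: 'a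
    unfolding cubic_def three by (simp add: power2_eq_square algebra_simps)
  have neq: "(1::'a) \<noteq> -1" using two by (simp add: eq_neg_iff_add_eq_0)
  have e1: "quad_char (cubic (1::'a)) = e"
    using quad_char_cubic_1[OF two] by (simp add: e_def)
  have e: "e = 1 \<or> e = -1" unfolding e_def by (rule quad_char_cases) simp
  have S: "cubic_sum TYPE('a) = -1"
  proof -
    have "quad_char (cubic z) = quad_char (z + 1)" if "z \<in> UNIV - {0}" for z :: 'a
      using that quad_char_mult_square[of z "z + 1"] by (simp add: cubic mult.commute)
    hence "(\<Sum>z\<in>UNIV - {0}. quad_char (cubic (z :: 'a))) = (\<Sum>z\<in>UNIV - {0}. quad_char (z + 1 :: 'a))"
      by (rule sum.cong[OF refl])
    \<comment> \<open>The subtracted 1 is \<open>quad_char 1\<close>, the term at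
      \<open>z = 0\<close>.\<close>
    also have "\<dots> = (\<Sum>z\<in>UNIV. quad_char (z + 1 :: 'a)) - 1"
      by (subst sum_diff1) auto
    also have "(\<Sum>z\<in>UNIV. quad_char (z + 1 :: 'a)) = (\<Sum>z\<in>(UNIV :: 'a set). quad_char z)"
      by (rule sum.reindex_bij_betw, rule bij_betw_byWitness[of _ "\<lambda>x. x - 1"]) auto
    finally show ?thesis
      unfolding cubic_sum_def using sum_quad_char[OF two] by (simp add: sum_diff1 cubic)
  qed
  note S' = S[unfolded cubic_sum_def]
  have "{z::'a. cubic z = 0} = {0, -1}" by (auto simp: cubic add_eq_0_iff2)
  hence A: "2 * real (card {z::'a. quad_char (cubic z) = 1}) = real (CARD('a)) - 3"
    using card_quad_char_eq_1[of "cubic :: 'a \<Rightarrow> 'a"] S by (simp add: cubic_sum_def)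
  have c0: "cubic (0::'a) = 0" by (simp add: cubic)
  have hops: "hops = {z::'a. quad_char (cubic z) = 1} - {1}"
    using c0 three by (auto simp: hops_def)
  show ?thesis1
  proof (cases "e = 1")
    case True
    hence "1 \<in> {z::'a. quad_char (cubic z) = 1}" using e1 by simp
    hence "card {z::'a. quad_char (cubic z) = 1} = Suc (card (hops :: 'a set))"
      unfolding hops by (rule card.remove[OF finite])
    thus ?thesis using A True by (simp add: field_simps)
  next
    case False
    hence "hops = {z::'a. quad_char (cubic z) = 1}" using e1 unfolding hops by auto
    thus ?thesis using A False e by simp
  qed
  let ?B = "{z::'a. quad_char (cubic z) = 1 \<and> quad_char (cubic (- z)) = 1}"
  have e2: "cubic (-1::'a) = 0" by (simp add: cubic)
  have zeros: "{z::'a. cubic z * cubic (- z) = 0} = {0, 1, -1}"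
    unfolding cubic_uminus using three by (auto simp: cubic add_eq_0_iff2)
  have "(\<Sum>z | cubic z * cubic (- z :: 'a) = 0. (1 + quad_char (cubic z)) * (1 + quad_char (cubic (- z)))) =
      1 + 2 * (1 + e)"
    unfolding zeros using neq by (simp add: e1 e2 c0)
  hence "4 * real (card ?B) = real (CARD('a)) - 6 - 3 * e"
    using card_quad_char_eq_1_both[OF two, of cubic "\<lambda>z. cubic (- z)"] S c0 three
      sum_quad_char_cubic_uminus[where ?'a = 'a] sum_quad_char_cubic_mult[OF two]
    by (simp add: e1 S')
  moreover have "?B = {z \<in> hops. quad_char (cubic (- z)) = 1}"
    using e2 unfolding hops by auto
  ultimately show ?thesis2 by simp
qed

section \<open>The closed formulas and their dependence on \<open>q\<close>\<close>

lemma I_D_char_neq_3: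
  assumes two: "(2::'a::{field, finite}) \<noteq> 0" and three: "(3::'a) \<noteq> 0"
  shows "real (I_D TYPE('a)) = 11 * real (CARD('a)) / 12 -
    real (card (rational_points (curve_L :: 'a weierstrass))) / 8 - 1 / 2 +
    quad_char (-1 :: 'a) / 4 + quad_char (-3 :: 'a) / 3"
  unfolding I_D_eq[OF two] card_hops_char_neq_3[OF two three] card_rational_points_curve_L[OF two]
  by (simp add: field_simps)

lemma I_D_char_3:
  assumes two: "(2::'a::{field, finite}) \<noteq> 0" and three: "(3::'a) = 0"
  shows "real (I_D TYPE('a)) = (19 * real (CARD('a)) - 30 + 3 * quad_char (-1 :: 'a)) / 24"
  unfolding I_D_eq[OF two] card_hops_char_3[OF two three]
  by (simp add: field_simps)

theorem theorem7:
  fixes q N :: nat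
  assumes char: "CHAR('a::{field, finite}) \<ge> 3"
    and q: "q = CARD('a)"
    and N: "N = card (rational_points (curve_L :: 'a weierstrass))"
  shows
    "(q mod 12 = 1 \<longrightarrow> real (I_D TYPE('a)) = (11 * real q + 1) / 12 - real N / 8) \<and>
     (q mod 12 = 5 \<longrightarrow> real (I_D TYPE('a)) = (11 * real q - 7) / 12 - real N / 8) \<and>
     (q mod 12 = 7 \<longrightarrow> real (I_D TYPE('a)) = (11 * real q - 5) / 12 - real N / 8) \<and>
     (q mod 12 = 11 \<longrightarrow> real (I_D TYPE('a)) = (11 * real q - 13) / 12 - real N / 8) \<and>
     (\<forall>k::nat. k > 0 \<and> q = 3 ^ (2 * k) \<longrightarrow> real (I_D TYPE('a)) = (19 * real q - 27) / 24) \<and>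
     (\<forall>k::nat. q = 3 ^ (2 * k + 1) \<longrightarrow> real (I_D TYPE('a)) = (19 * real q - 33) / 24)"
proof -
  have two: "(2::'a) \<noteq> 0"
  proof
    assume "(2::'a) = 0"
    hence "CHAR('a) dvd 2" by (simp flip: of_nat_eq_0_iff_char_dvd)
    hence "CHAR('a) \<le> 2" by (rule dvd_imp_le) simp
    thus False using char by simp
  qed
  have main: "real (I_D TYPE('a)) = 11 * real q / 12 - real N / 8 - 1 / 2 +
      (if q mod 4 = 1 then 1 else -1) / 4 + (if q mod 3 = 1 then 1 else -1) / 3"
    if "\<not> 3 dvd q"
  proof -
    have three: "(3::'a) \<noteq> 0"
    proof
      assume "(3::'a) = 0"
      hence "CHAR('a) dvd 3" by (simp flip: of_nat_eq_0_iff_char_dvd)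
      hence "CHAR('a) = 3" using char dvd_imp_le[of "CHAR('a)" 3] by simp
      moreover have "CHAR('a) dvd q"
        unfolding q of_nat_eq_0_iff_char_dvd[symmetric] by (rule of_nat_card_eq_0)
      ultimately show False using that by simp
    qed
    show ?thesis
      using I_D_char_neq_3[OF two three] quad_char_minus_1[OF two]
        quad_char_minus_3[OF two three] that unfolding q N by simp
  qed
  have char_3: "real (I_D TYPE('a)) = (19 * real q - 30 + 3 * (if q mod 4 = 1 then 1 else -1)) / 24"
    if "q = 3 ^ n" for n
  proof -
    \<comment> \<open>\<open>q\<close> vanishes in the field, and a field has no nilpotents, so
      \<open>3 = 0\<close>.\<close>
    have "(3::'a) ^ n = 0" using of_nat_card_eq_0[where ?'a = 'a] that unfolding q[symmetric] by simp
    hence three: "(3::'a) = 0" by simp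
    show ?thesis using I_D_char_3[OF two three] quad_char_minus_1[OF two] unfolding q by simp
  qed
  \<comment> \<open>Even powers of 3 are 1 modulo 4 and odd ones are 3, which decides the character
    of \<open>-1\<close>.\<close>
  have nine: "(3::nat) ^ (2 * k) mod 4 = 1" for k
  proof (induction k)
    case (Suc k)
    have "(3::nat) ^ (2 * Suc k) = 9 * 3 ^ (2 * k)" by simp
    thus ?case using Suc by presburger
  qed simp
  have square: "real (I_D TYPE('a)) = (19 * real q - 27) / 24" if "q = 3 ^ (2 * k)" for k
  proof -
    have "q mod 4 = 1" using nine[of k] that by simp
    thus ?thesis using char_3[OF that] by simp
  qed
  have nonsquare: "real (I_D TYPE('a)) = (19 * real q - 33) / 24" if "q = 3 ^ (2 * k + 1)" for k
  proof -
    have "q = 3 * 3 ^ (2 * k)" using that by simp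
    hence "q mod 4 \<noteq> 1" using nine[of k] by presburger
    thus ?thesis using char_3[OF that] by simp
  qed
  have mods: "q mod 4 = q mod 12 mod 4" "q mod 3 = q mod 12 mod 3"
    by (simp_all add: mod_mod_cancel)
  show ?thesis
  proof (intro conjI allI impI)
    assume "q mod 12 = 1"
    hence "q mod 4 = 1" "q mod 3 = 1" using mods by simp_all
    thus "real (I_D TYPE('a)) = (11 * real q + 1) / 12 - real N / 8"
      using main by (simp add: dvd_eq_mod_eq_0)
  next
    assume "q mod 12 = 5"
    hence "q mod 4 = 1" "q mod 3 = 2" using mods by simp_all
    thus "real (I_D TYPE('a)) = (11 * real q - 7) / 12 - real N / 8"
      using main by (simp add: dvd_eq_mod_eq_0)
  next
    assume "q mod 12 = 7"
    hence "q mod 4 = 3" "q mod 3 = 1" using mods by simp_all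
    thus "real (I_D TYPE('a)) = (11 * real q - 5) / 12 - real N / 8"
      using main by (simp add: dvd_eq_mod_eq_0)
  next
    assume "q mod 12 = 11"
    hence "q mod 4 = 3" "q mod 3 = 2" using mods by simp_all
    thus "real (I_D TYPE('a)) = (11 * real q - 13) / 12 - real N / 8"
      using main by (simp add: dvd_eq_mod_eq_0)
  qed (use square nonsquare in blast)+
qed

end
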